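(* Let $F$ be a field. Then (i) $(\mathcal{L}_F^{\ast},+,\cdot)$ is a commutative semiring graded by the multiplicative monoid $(F^{\ast},\cdot)$. (ii) $(\mathcal{L}_F,+,\cdot)$ is a commutative semiring graded by the multiplicative monoid $(F,\cdot)$.
   Context: Let $F^{\ast}=F\setminus\{0\}$. Let $\mathcal{C}_F$ be the set of all sequences $(s_n)_{n\ge 0}$ over $F$, with componentwise addition and Hadamard (componentwise) product. For $F$-subspaces $H,H'$ of $\mathcal{C}_F$, $H+H'$ is the sum of subspaces and $HH'$ (or $H\cdot H'$) is the subspace spanned by all Hadamard products $cd$ with $c\in H$, $d\in H'$. For a monic polynomial $P=X^d+c_{d-1}X^{d-1}+\cdots+c_0\in F[X]$, $L(P)$ is the $F$-vector space of all linear recurrence sequences over $F$ with characteristic polynomial $P$, i.e. of all sequences $(s_n)_{n\ge0}$ over $F$ with $s_{n+d}+c_{d-1}s_{n+d-1}+\cdots+c_0s_n=0$ for all $n\ge0$ (so $L(1)=\{0\}$). $\mathcal{L}_F$ is the set of all $L(P)$ with $P$ monic and split over $F$; $\mathcal{L}_F^{\ast}$ is the set of all $L(P)$ with $P$ monic with all roots in $F^{\ast}$ (that is, $P$ splits over $F$ and $P(0)\neq 0$). The operations on $\mathcal{L}_F$ and $\mathcal{L}_F^{\ast}$ are the sum $+$ and product $\cdot$ of subspaces just defined. A commutative semiring is a nonempty set $S$ with two associative binary operations $+,\cdot$ such that $(S,+)$ is a commutative monoid with neutral element $0$, $0\cdot a=0$ for all $a\in S$, $(S,\cdot)$ is a commutative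 monoid with neutral element $1\ne0$, and $\cdot$ distributes over $+$. Let $(G,\star)$ be a monoid. A semiring $R$ is said to be graded by $G$ if there exists a family $\{R_\alpha\}_{\alpha\in G}$ of additive subsemigroups of $R$ such that: (1) $R=\sum_{\alpha\in G}R_\alpha$; (2) $R_\alpha R_\beta\subseteq R_{\alpha\star\beta}$ for all $\alpha,\beta\in G$; (3) if $a_{\alpha_1},\dots,a_{\alpha_m}$ are nonzero elements of $R$ with $a_{\alpha_i}\in R_{\alpha_i}$ and $\alpha_i\ne\alpha_j$ for $i\neq j$, then $\sum_{i=1}^m a_{\alpha_i}\neq0$. *)

theory Defs
  imports
    "HOL-Computational_Algebra.Polynomial"
    "HOL-Library.Multiset"
    "HOL-Library.Function_Algebras"
    "HOL-Algebra.Ring"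
begin

section \<open>Subspaces of the space of sequences\<close>

text \<open>Sequences over the field are functions on \<^typ>\<open>nat\<close>; their componentwise sum and Hadamard
  product are the pointwise operations of \<^theory>\<open>HOL-Library.Function_Algebras\<close>.\<close>

definition seq_scale :: "'a::field \<Rightarrow> (nat \<Rightarrow> 'a) \<Rightarrow> (nat \<Rightarrow> 'a)" where
  "seq_scale k s = (\<lambda>n. k * s n)"

interpretation seqs: vector_space seq_scale
  by unfold_locales (auto simp: seq_scale_def fun_eq_iff algebra_simps)

definition subspace_sum :: "(nat \<Rightarrow> 'a::field) set \<Rightarrow> (nat \<Rightarrow> 'a) set \<Rightarrow> (nat \<Rightarrow> 'a) set" where
  "subspace_sum H H' = {c + d | c d. c \<in> H \<and> d \<in> H'}"

definition subspace_prod :: "(nat \<Rightarrow> 'a::field) set \<Rightarrow> (nat \<Rightarrow> 'a) set \<Rightarrow> (nat \<Rightarrow> 'a) set" where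
  "subspace_prod H H' = seqs.span {c * d | c d. c \<in> H \<and> d \<in> H'}"


section \<open>Spaces of linear recurrence sequences\<close>

text \<open>Only meaningful for monic \<open>P\<close>: the leading coefficient is taken to be 1.\<close>

definition lin_rec_space :: "'a::field poly \<Rightarrow> (nat \<Rightarrow> 'a) set" where
  "lin_rec_space P =
     {s. \<forall>n. s (n + degree P) + (\<Sum>i<degree P. coeff P i * s (n + i)) = 0}"

definition splits :: "'a::field poly \<Rightarrow> bool" where
  "splits P \<longleftrightarrow> (\<exists>c A. P = smult c (\<Prod>a\<in>#A. [:- a, 1:]))"

definition rec_spaces :: "(nat \<Rightarrow> 'a::field) set set" where
  "rec_spaces = {lin_rec_space P | P. lead_coeff P = 1 \<and> splits P}"

definition rec_spaces_star :: "(nat \<Rightarrow> 'a::field) set set" where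
  "rec_spaces_star = {lin_rec_space P | P. lead_coeff P = 1 \<and> splits P \<and> poly P 0 \<noteq> 0}"

text \<open>A set of subspaces with sum and product of subspaces. The designated neutral elements are
  \<open>L(1) = {0}\<close> and \<open>L(X - 1)\<close>, the space of constant sequences.\<close>

definition subspace_semiring :: "(nat \<Rightarrow> 'a::field) set set \<Rightarrow> (nat \<Rightarrow> 'a) set ring" where
  "subspace_semiring S =
     \<lparr>carrier = S, monoid.mult = subspace_prod, one = lin_rec_space [:- 1, 1:],
      zero = lin_rec_space 1, add = subspace_sum\<rparr>"


section \<open>Graded semirings\<close>

text \<open>The library's \<^locale>\<open>semiring\<close> requires neither commutativity of multiplication nor
  that 0 and 1 are distinct.\<close>

locale commutative_semiring = semiring R + comm_monoid R for R (structure) +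
  assumes one_not_zero: "\<one> \<noteq> \<zero>"

definition additive_subsemigroup :: "'r set \<Rightarrow> ('r, 'm) ring_scheme \<Rightarrow> bool" where
  "additive_subsemigroup H R \<longleftrightarrow>
     H \<noteq> {} \<and> H \<subseteq> carrier R \<and> (\<forall>x\<in>H. \<forall>y\<in>H. x \<oplus>\<^bsub>R\<^esub> y \<in> H)"

text \<open>The sum of a possibly infinite family consists of the sums over its finite subfamilies.\<close>

definition is_grading ::
  "('r, 'm) ring_scheme \<Rightarrow> ('g, 'n) monoid_scheme \<Rightarrow> ('g \<Rightarrow> 'r set) \<Rightarrow> bool" where
  "is_grading R G C \<longleftrightarrow>
     (\<forall>\<alpha>\<in>carrier G. additive_subsemigroup (C \<alpha>) R) \<and>
     carrier R = {(\<Oplus>\<^bsub>R\<^esub>\<alpha>\<in>A. a \<alpha>) | a A. finite A \<and> A \<subseteq> carrier G \<and> (\<forall>\<alpha>\<in>A. a \<alpha> \<in> C \<alpha>)} \<and>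
     (\<forall>\<alpha>\<in>carrier G. \<forall>\<beta>\<in>carrier G. \<forall>x\<in>C \<alpha>. \<forall>y\<in>C \<beta>. x \<otimes>\<^bsub>R\<^esub> y \<in> C (\<alpha> \<otimes>\<^bsub>G\<^esub> \<beta>)) \<and>
     (\<forall>A a. finite A \<and> A \<noteq> {} \<and> A \<subseteq> carrier G \<and> (\<forall>\<alpha>\<in>A. a \<alpha> \<in> C \<alpha> \<and> a \<alpha> \<noteq> \<zero>\<^bsub>R\<^esub>) \<longrightarrow>
        (\<Oplus>\<^bsub>R\<^esub>\<alpha>\<in>A. a \<alpha>) \<noteq> \<zero>\<^bsub>R\<^esub>)"

definition graded_by :: "('r, 'm) ring_scheme \<Rightarrow> ('g, 'n) monoid_scheme \<Rightarrow> bool" where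
  "graded_by R G \<longleftrightarrow> semiring R \<and> monoid G \<and> (\<exists>C. is_grading R G C)"

definition mult_monoid :: "'a::field set \<Rightarrow> 'a monoid" where
  "mult_monoid M = \<lparr>carrier = M, monoid.mult = (*), one = 1\<rparr>"

end

(* With E the shift operator, L(P) is the kernel of P(E), so that L(P) + L(Q) = L(lcm(P, Q)) by Bezout.
   A split space is thus the sum of its primary parts L((X - a)^k), and these parts are the graded pieces.
   The product of L((X - a)^m) and L((X - b)^n) is stable under E and, by the twisted Leibniz rule
     (E - ab)(cd) = (E - a)c * Ed + a * c * (E - b)d,
   is killed by a power of E - ab. Since L((X - c)^(k+1)) / L((X - c)^k) has dimension at most 1, the only
   (E - c)-stable subspaces of L((X - c)^N) are the spaces L((X - c)^k); so the product is again of this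
   form, in every characteristic and also for zero roots, without any formula for its exponent. *)

theory Submission
  imports Defs "HOL-Library.Set_Algebras"
begin

section \<open>Polynomials in the shift operator\<close>

definition shift :: "(nat \<Rightarrow> 'a::field) \<Rightarrow> (nat \<Rightarrow> 'a)" where
  "shift s = (\<lambda>n. s (Suc n))"

text \<open>This is P(E)s for every \<open>P\<close>, monic or not. Keeping the leading coefficient
  makes it additive in \<open>P\<close>, unlike the formula in \<open>lin_rec_space\<close>.\<close>

definition act :: "'a::field poly \<Rightarrow> (nat \<Rightarrow> 'a) \<Rightarrow> (nat \<Rightarrow> 'a)" where
  "act P s = (\<lambda>n. \<Sum>i\<le>degree P. coeff P i * s (n + i))"

text \<open>Polynomials of different degrees get a common summation range, even where the degree of
  a sum drops.\<close>

lemma act_bound: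
  assumes "degree P \<le> N"
  shows "act P s n = (\<Sum>i\<le>N. coeff P i * s (n + i))"
  unfolding act_def
  by (rule sum.mono_neutral_left) (use assms in \<open>auto simp: coeff_eq_0\<close>)

lemma act_0 [simp]: "act 0 s = 0"
  by (simp add: act_def fun_eq_iff)

lemma act_1 [simp]: "act 1 s = s"
  by (simp add: act_def fun_eq_iff)

lemma act_add: "act (P + Q) s = act P s + act Q s"
proof
  fix n
  let ?N = "max (degree P) (degree Q)"
  have "degree (P + Q) \<le> ?N" by (rule degree_add_le_max)
  then show "act (P + Q) s n = (act P s + act Q s) n"
    by (simp add: act_bound[of _ ?N] sum.distrib algebra_simps)
qed

lemma act_smult: "act (smult c P) s = seq_scale c (act P s)"
proof
  fix n
  show "act (smult c P) s n = seq_scale c (act P s) n"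
    by (simp add: act_bound[of _ "degree P"] seq_scale_def sum_distrib_left mult.assoc)
qed

lemma act_pCons: "act (pCons a P) s = seq_scale a s + act P (shift s)"
proof
  fix n
  \<comment> \<open>For \<open>P = 0\<close> the two degrees agree, so \<open>Suc (degree P)\<close>
    serves only as an upper bound.\<close>
  have "degree (pCons a P) \<le> Suc (degree P)" by (rule degree_pCons_le)
  then show "act (pCons a P) s n = (seq_scale a s + act P (shift s)) n"
    by (simp only: act_bound[of _ "Suc (degree P)"] act_bound[of _ "degree P"] order_refl
        sum.atMost_Suc_shift[of _ "degree P"])
      (simp add: act_def shift_def seq_scale_def)
qed

lemma shift_act: "act P (shift s) = shift (act P s)"
  by (simp add: act_def shift_def)

text \<open>Sequences become a module over F[X]. Induction on the coefficients of \<open>P\<close>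
  works because E commutes with every P(E).\<close>

lemma act_mult: "act (P * Q) s = act P (act Q s)"
proof (induction P arbitrary: s)
  case 0
  show ?case by simp
next
  case (pCons a P)
  have "act (pCons a P * Q) s = seq_scale a (act Q s) + act (P * Q) (shift s)"
    by (simp add: act_add act_smult act_pCons)
  also have "\<dots> = act (pCons a P) (act Q s)"
    by (simp add: pCons.IH shift_act act_pCons)
  finally show ?case .
qed

lemma act_commute: "act P (act Q s) = act Q (act P s)"
  by (simp add: act_mult[symmetric] mult.commute)

lemma act_add_right: "act P (s + t) = act P s + act P t"
  by (simp add: act_def fun_eq_iff sum.distrib algebra_simps)

lemma act_scale_right: "act P (seq_scale c s) = seq_scale c (act P s)"
  by (simp add: act_def seq_scale_def fun_eq_iff sum_distrib_left algebra_simps)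

lemma act_zero_right [simp]: "act P 0 = 0"
  by (simp add: act_def fun_eq_iff)

lemma act_linear: "act [:- a, 1:] s n = s (Suc n) - a * s n"
  by (simp add: act_def)

lemma lin_rec_space_eq_kernel:
  assumes "lead_coeff P = 1"
  shows "lin_rec_space P = {s. act P s = 0}"
proof -
  have "act P s n = s (n + degree P) + (\<Sum>i<degree P. coeff P i * s (n + i))" for s n
    using assms by (simp add: act_def lessThan_Suc_atMost[symmetric] add.commute)
  then show ?thesis by (simp add: lin_rec_space_def fun_eq_iff)
qed


section \<open>Recurrence spaces as a function of the multiset of roots\<close>

text \<open>Recording roots with multiplicity turns divisibility into \<open>\<subseteq>#\<close>
  and least common multiples into \<open>\<union>#\<close>.\<close>

definition root_poly :: "'a::field multiset \<Rightarrow> 'a poly" where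
  "root_poly A = (\<Prod>a\<in>#A. [:- a, 1:])"

definition root_space :: "'a::field multiset \<Rightarrow> (nat \<Rightarrow> 'a) set" where
  "root_space A = {s. act (root_poly A) s = 0}"

lemma root_poly_empty [simp]: "root_poly {#} = 1"
  by (simp add: root_poly_def)

lemma root_poly_add_mset [simp]: "root_poly (add_mset a A) = [:- a, 1:] * root_poly A"
  by (simp add: root_poly_def)

lemma root_poly_union: "root_poly (A + B) = root_poly A * root_poly B"
  by (simp add: root_poly_def)

lemma lead_coeff_root_poly: "lead_coeff (root_poly A) = 1"
proof (induction A)
  case (add a A)
  show ?case
    unfolding root_poly_add_mset lead_coeff_mult add.IH by simp
qed simp

lemma poly_root_poly_eq_0: "poly (root_poly A) x = 0 \<longleftrightarrow> x \<in># A"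
  by (induction A) (auto simp del: mult_pCons_left)

lemma root_space_eq: "root_space A = lin_rec_space (root_poly A)"
  by (simp add: root_space_def lin_rec_space_eq_kernel[OF lead_coeff_root_poly])

text \<open>Comparing leading coefficients forces the scalar in \<open>splits\<close> to be
  1.\<close>

lemma monic_splits_iff: "lead_coeff P = 1 \<and> splits P \<longleftrightarrow> (\<exists>A. P = root_poly A)"
proof
  assume P: "lead_coeff P = 1 \<and> splits P"
  then obtain c A where cA: "P = smult c (root_poly A)"
    by (auto simp: splits_def root_poly_def)
  with P lead_coeff_root_poly[of A] have "c = 1" by (simp only: lead_coeff_smult mult_1_right)
  with cA show "\<exists>A. P = root_poly A" by auto
next
  assume "\<exists>A. P = root_poly A"
  then obtain A where "P = root_poly A" ..
  moreover have "splits (root_poly A)"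
    unfolding splits_def root_poly_def by (rule exI[of _ 1], rule exI[of _ A]) simp
  ultimately show "lead_coeff P = 1 \<and> splits P" by (simp add: lead_coeff_root_poly)
qed

text \<open>Both claims become instances of one result about a set \<open>M\<close> of admissible
  roots that contains 1 and is closed under multiplication.\<close>

definition rec_spaces_over :: "'a::field set \<Rightarrow> (nat \<Rightarrow> 'a) set set" where
  "rec_spaces_over M = {root_space A | A. set_mset A \<subseteq> M}"

lemma rec_spaces_eq: "rec_spaces = rec_spaces_over UNIV"
proof -
  have "rec_spaces = {lin_rec_space P | P. \<exists>A. P = root_poly A}"
    unfolding rec_spaces_def using monic_splits_iff by blast
  then show ?thesis by (auto simp: rec_spaces_over_def root_space_eq)
qed

lemma rec_spaces_star_eq:
  "(rec_spaces_star :: (nat \<Rightarrow> 'a::field) set set) = rec_spaces_over (UNIV - {0})"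
proof -
  have "lead_coeff P = 1 \<and> splits P \<and> poly P 0 \<noteq> 0 \<longleftrightarrow>
      (\<exists>A. P = root_poly A \<and> set_mset A \<subseteq> UNIV - {0})" for P :: "'a poly"
    using monic_splits_iff[of P] by (auto simp: poly_root_poly_eq_0)
  then show ?thesis
    by (auto simp: rec_spaces_star_def rec_spaces_over_def root_space_eq simp del: Diff_iff)
qed

lemma subspace_root_space: "seqs.subspace (root_space A)"
  by (rule seqs.subspaceI) (auto simp: root_space_def act_add_right act_scale_right)

lemma zero_in_root_space: "0 \<in> root_space A"
  by (rule seqs.subspace_0[OF subspace_root_space])

lemma act_in_root_space: "s \<in> root_space A \<Longrightarrow> act P s \<in> root_space A"
  using act_commute[of "root_poly A" P s] by (simp add: root_space_def)

lemma shift_in_root_space: "s \<in> root_space A \<Longrightarrow> shift s \<in> root_space A"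
  by (simp add: root_space_def shift_act) (simp add: shift_def fun_eq_iff)

lemma root_space_empty: "root_space {#} = {0}"
  by (simp add: root_space_def)

text \<open>Applying E - a removes one root; this drives the inductions on multiplicity
  below.\<close>

lemma root_space_add_mset: "s \<in> root_space (add_mset a A) \<longleftrightarrow> act [:- a, 1:] s \<in> root_space A"
  by (simp only: root_space_def root_poly_add_mset mem_Collect_eq mult.commute[of "[:- a, 1:]"] act_mult)

lemma root_space_mono:
  assumes "A \<subseteq># B"
  shows "root_space A \<subseteq> root_space B"
proof -
  obtain C where "B = C + A" using assms by (metis subset_mset.add_diff_inverse add.commute)
  then show ?thesis by (auto simp: root_space_def root_poly_union act_mult)
qed


section \<open>Sums\<close>

text \<open>Coprimality in Bezout form: the cofactors \<open>u\<close> and \<open>v\<close> will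
  themselves act on sequences.\<close>

definition comaximal :: "'a::field poly \<Rightarrow> 'a poly \<Rightarrow> bool" where
  "comaximal P Q \<longleftrightarrow> (\<exists>u v. u * P + v * Q = 1)"

text \<open>Insert the Bezout relation for \<open>Q\<close> and \<open>R\<close> as a factor 1 into
  the term u P of the relation for \<open>P\<close> and \<open>R\<close>.\<close>

lemma comaximal_mult:
  assumes "comaximal P R" "comaximal Q R"
  shows "comaximal (P * Q) R"
proof -
  obtain u v u' v' where e: "u * P + v * R = 1" "u' * Q + v' * R = 1"
    using assms by (auto simp: comaximal_def)
  have "(u * u') * (P * Q) + (u * P * v' + v) * R = u * P * (u' * Q + v' * R) + v * R"
    by (simp add: algebra_simps)
  also have "\<dots> = 1" by (simp add: e)
  finally show ?thesis unfolding comaximal_def by blast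
qed

text \<open>Division of \<open>P\<close> by X - a leaves the constant remainder P(a), which is
  invertible.\<close>

lemma comaximal_linear:
  assumes "poly P a \<noteq> 0"
  shows "comaximal [:- a, 1:] P"
proof -
  have "P = [:- a, 1:] * synthetic_div P a + [:poly P a:]"
    using synthetic_div_correct'[of a P] by simp
  then have "smult (inverse (poly P a)) (P - [:- a, 1:] * synthetic_div P a) = 1"
    using assms by (metis (no_types) add_diff_cancel_left' one_pCons smult_pCons smult_0_right left_inverse)
  moreover have "smult (- k) S * L + [:k:] * P = smult k (P - L * S)" for k and L S :: "'a poly"
    by (simp add: smult_diff_right mult.commute)
  ultimately have "smult (- inverse (poly P a)) (synthetic_div P a) * [:- a, 1:]
      + [:inverse (poly P a):] * P = 1"
    by metis
  then show ?thesis unfolding comaximal_def by blast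
qed

lemma comaximal_root_poly:
  assumes "set_mset A \<inter> set_mset B = {}"
  shows "comaximal (root_poly A) (root_poly B)"
  using assms
proof (induction A)
  case empty
  have "1 * 1 + 0 * root_poly B = 1" by simp
  then show ?case unfolding comaximal_def root_poly_empty by blast
next
  case (add a A)
  then have "comaximal [:- a, 1:] (root_poly B)"
    by (intro comaximal_linear) (simp add: poly_root_poly_eq_0)
  with add show ?case unfolding root_poly_add_mset by (intro comaximal_mult) auto
qed

lemma subspace_sum_root_space:
  "subspace_sum (root_space A) (root_space B) = root_space (A \<union># B)"
proof
  have "seqs.subspace (root_space (A \<union># B))" by (rule subspace_root_space)
  moreover have "root_space A \<subseteq> root_space (A \<union># B)" "root_space B \<subseteq> root_space (A \<union># B)"
    by (auto intro!: root_space_mono)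
  ultimately show "subspace_sum (root_space A) (root_space B) \<subseteq> root_space (A \<union># B)"
    by (auto simp: subspace_sum_def intro: seqs.subspace_add)
next
  \<comment> \<open>These are the roots of the cofactors lcm/Q and lcm/P. They are disjoint, and the
    polynomial of \<open>A'\<close> maps the large space into \<open>root_space B\<close>, that of
    \<open>B'\<close> into \<open>root_space A\<close>.\<close>
  define A' B' where "A' = A - B" and "B' = B - A"
  have "set_mset A' \<inter> set_mset B' = {}"
    by (auto simp: A'_def B'_def in_diff_count)
  then obtain u v where uv: "u * root_poly A' + v * root_poly B' = 1"
    using comaximal_root_poly unfolding comaximal_def by blast
  have AB: "A \<union># B = A' + B" "A \<union># B = B' + A"
    by (auto simp: A'_def B'_def multiset_eq_iff)
  show "root_space (A \<union># B) \<subseteq> subspace_sum (root_space A) (root_space B)"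
  proof
    fix s assume s: "s \<in> root_space (A \<union># B)"
    have "act (root_poly A') s \<in> root_space B"
      using s by (simp add: AB(1) root_space_def root_poly_union act_mult act_commute)
    moreover have "act (root_poly B') s \<in> root_space A"
      using s by (simp add: AB(2) root_space_def root_poly_union act_mult act_commute)
    moreover have "s = act v (act (root_poly B') s) + act u (act (root_poly A') s)"
      using act_1[of s] unfolding uv[symmetric] act_add act_mult by (simp add: add.commute)
    ultimately show "s \<in> subspace_sum (root_space A) (root_space B)"
      unfolding subspace_sum_def using act_in_root_space by blast
  qed
qed

text \<open>Elementwise addition of sets supplies associativity and commutativity.\<close>

lemma subspace_sum_eq_set_plus: "subspace_sum U V = U + V"
  by (auto simp: subspace_sum_def set_plus_def)

lemma subspace_sum_assoc: "subspace_sum (subspace_sum U V) W = subspace_sum U (subspace_sum V W)"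
  by (simp add: subspace_sum_eq_set_plus add.assoc)

lemma subspace_sum_commute: "subspace_sum U V = subspace_sum V U"
  by (simp add: subspace_sum_eq_set_plus add.commute)

lemma subspace_sum_zero: "subspace_sum {0} U = U"
  by (auto simp: subspace_sum_def)

lemma subspace_sum_superset: "0 \<in> V \<Longrightarrow> U \<subseteq> subspace_sum U V"
  unfolding subspace_sum_def by (force intro: exI[of _ 0])


section \<open>Products\<close>

lemma subspace_subspace_prod: "seqs.subspace (subspace_prod U V)"
  by (simp add: subspace_prod_def)

lemma subspace_prod_mem: "c \<in> U \<Longrightarrow> d \<in> V \<Longrightarrow> c * d \<in> subspace_prod U V"
  unfolding subspace_prod_def by (rule seqs.span_base) blast

lemma subspace_prod_least:
  assumes "seqs.subspace T" "\<And>c d. c \<in> U \<Longrightarrow> d \<in> V \<Longrightarrow> c * d \<in> T"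
  shows "subspace_prod U V \<subseteq> T"
  unfolding subspace_prod_def using assms by (intro seqs.span_minimal) auto

lemma subspace_prod_mono: "U \<subseteq> U' \<Longrightarrow> V \<subseteq> V' \<Longrightarrow> subspace_prod U V \<subseteq> subspace_prod U' V'"
  by (intro subspace_prod_least subspace_subspace_prod subspace_prod_mem) auto

lemma subspace_prod_commute: "subspace_prod U V = subspace_prod V U"
proof -
  have "{c * d | c d. c \<in> U \<and> d \<in> V} = {c * d | c d. c \<in> V \<and> d \<in> U}"
    using mult.commute by blast
  then show ?thesis by (simp add: subspace_prod_def)
qed

text \<open>A linear property has to be checked only on the spanning Hadamard products.\<close>

lemma subspace_prod_induct [consumes 1, case_names subspace mult]:
  assumes "x \<in> subspace_prod U V" "seqs.subspace {x. Q x}"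
    and "\<And>c d. c \<in> U \<Longrightarrow> d \<in> V \<Longrightarrow> Q (c * d)"
  shows "Q x"
  using subspace_prod_least[of "{x. Q x}" U V] assms by blast

text \<open>Multiplication by \<open>d\<close> is linear, so associativity can be tested on
  generators of the left factor.\<close>

lemma subspace_vimage_mult:
  assumes "seqs.subspace T"
  shows "seqs.subspace {c. c * d \<in> T}"
proof (rule seqs.subspaceI)
  show "0 \<in> {c. c * d \<in> T}" using seqs.subspace_0[OF assms] by simp
next
  fix x y assume "x \<in> {c. c * d \<in> T}" "y \<in> {c. c * d \<in> T}"
  then show "x + y \<in> {c. c * d \<in> T}" using seqs.subspace_add[OF assms] by (simp add: distrib_right)
next
  fix k x assume "x \<in> {c. c * d \<in> T}"
  moreover have "seq_scale k x * d = seq_scale k (x * d)"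
    by (simp add: seq_scale_def fun_eq_iff mult.assoc)
  ultimately show "seq_scale k x \<in> {c. c * d \<in> T}" using seqs.subspace_scale[OF assms] by simp
qed

lemma subspace_prod_assoc_le:
  "subspace_prod (subspace_prod U V) W \<subseteq> subspace_prod U (subspace_prod V W)"
proof (rule subspace_prod_least[OF subspace_subspace_prod])
  fix c d assume "c \<in> subspace_prod U V" and d: "d \<in> W"
  from this(1) show "c * d \<in> subspace_prod U (subspace_prod V W)"
  proof (induction rule: subspace_prod_induct)
    case subspace
    show ?case by (rule subspace_vimage_mult[OF subspace_subspace_prod])
  next
    case (mult a b)
    then show ?case using d by (metis mult.assoc subspace_prod_mem)
  qed
qed

text \<open>The reverse inclusion is the one just shown, applied to the factors in reverse order and
  rewritten by commutativity.\<close>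

lemma subspace_prod_assoc: "subspace_prod (subspace_prod U V) W = subspace_prod U (subspace_prod V W)"
  using subspace_prod_assoc_le[of U V W] subspace_prod_assoc_le[of W V U]
  by (simp add: subspace_prod_commute)

lemma subspace_prod_sum_distrib:
  assumes "seqs.subspace V" "seqs.subspace W"
  shows "subspace_prod (subspace_sum V W) U = subspace_sum (subspace_prod V U) (subspace_prod W U)"
proof
  have sub: "seqs.subspace (subspace_sum (subspace_prod V U) (subspace_prod W U))"
    unfolding subspace_sum_def
    by (intro seqs.subspace_sums subspace_subspace_prod)
  show "subspace_prod (subspace_sum V W) U \<subseteq> subspace_sum (subspace_prod V U) (subspace_prod W U)"
  proof (rule subspace_prod_least[OF sub])
    fix c d assume "c \<in> subspace_sum V W" "d \<in> U"
    then obtain x y where "c = x + y" "x \<in> V" "y \<in> W" by (auto simp: subspace_sum_def)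
    then show "c * d \<in> subspace_sum (subspace_prod V U) (subspace_prod W U)"
      unfolding subspace_sum_def using \<open>d \<in> U\<close>
      by (auto simp: distrib_right intro: subspace_prod_mem)
  qed
  \<comment> \<open>Here \<open>V\<close> and \<open>W\<close> being subspaces matters: each
    contains 0, so each summand lies in the sum.\<close>
  have "V \<subseteq> subspace_sum V W" "W \<subseteq> subspace_sum V W"
    using subspace_sum_superset[of V W] subspace_sum_superset[of W V] assms
    by (simp_all add: seqs.subspace_0 subspace_sum_commute)
  then have "subspace_prod V U \<subseteq> subspace_prod (subspace_sum V W) U"
    "subspace_prod W U \<subseteq> subspace_prod (subspace_sum V W) U"
    by (simp_all add: subspace_prod_mono)
  then show "subspace_sum (subspace_prod V U) (subspace_prod W U) \<subseteq> subspace_prod (subspace_sum V W) U"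
    unfolding subspace_sum_def using seqs.subspace_add[OF subspace_subspace_prod] by blast
qed

lemma subspace_prod_zero: "subspace_prod {0} U = {0}"
proof
  show "subspace_prod {0} U \<subseteq> {0}"
    by (rule subspace_prod_least) (auto simp: seqs.subspace_single_0)
  show "{0} \<subseteq> subspace_prod {0} U"
    using seqs.subspace_0[OF subspace_subspace_prod] by simp
qed

section \<open>The constant sequences as unit of the product\<close>

lemma root_space_one: "root_space {#1#} = (range (\<lambda>c n. c) :: (nat \<Rightarrow> 'a::field) set)"
proof
  show "root_space {#1#} \<subseteq> (range (\<lambda>c n. c) :: (nat \<Rightarrow> 'a) set)"
  proof
    fix s :: "nat \<Rightarrow> 'a" assume "s \<in> root_space {#1#}"
    then have "s (Suc n) = s n" for n
      using act_linear[of 1 s n] by (simp add: root_space_def)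
    then have "s n = s 0" for n by (induction n) auto
    then show "s \<in> range (\<lambda>c n. c)" by auto
  qed
  show "(range (\<lambda>c n. c) :: (nat \<Rightarrow> 'a) set) \<subseteq> root_space {#1#}"
    by (auto simp: root_space_def fun_eq_iff act_linear)
qed

lemma subspace_prod_one:
  fixes U :: "(nat \<Rightarrow> 'a::field) set"
  assumes "seqs.subspace U"
  shows "subspace_prod (root_space {#1#}) U = U"
proof
  show "subspace_prod (root_space {#1#}) U \<subseteq> U"
  proof (rule subspace_prod_least[OF assms])
    fix c d :: "nat \<Rightarrow> 'a" assume "c \<in> root_space {#1#}" "d \<in> U"
    then obtain k where "c * d = seq_scale k d"
      by (auto simp: root_space_one seq_scale_def fun_eq_iff)
    then show "c * d \<in> U" using seqs.subspace_scale[OF assms \<open>d \<in> U\<close>] by simp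
  qed
  show "U \<subseteq> subspace_prod (root_space {#1#}) U"
  proof
    fix d assume "d \<in> U"
    moreover have "1 \<in> root_space {#1#}" by (simp add: root_space_def fun_eq_iff act_linear)
    ultimately have "1 * d \<in> subspace_prod (root_space {#1#}) U" by (rule subspace_prod_mem[rotated])
    then show "d \<in> subspace_prod (root_space {#1#}) U" by simp
  qed
qed


section \<open>Shift-invariant subspaces for a single root\<close>

abbreviation power_space :: "nat \<Rightarrow> 'a::field \<Rightarrow> (nat \<Rightarrow> 'a) set" where
  "power_space k a \<equiv> root_space (replicate_mset k a)"

text \<open>E - a embeds each quotient of consecutive levels into the quotient one level lower. At
  the bottom, a sequence is determined by its first term.\<close>

lemma power_space_codim_le_1:
  assumes "s \<in> power_space (Suc k) a" "s \<notin> power_space k a" "t \<in> power_space (Suc k) a"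
  shows "\<exists>c. t - seq_scale c s \<in> power_space k a"
  using assms
proof (induction k arbitrary: s t)
  case 0
  \<comment> \<open>For \<open>a = 0\<close> this still holds with \<open>a ^ 0 = 1\<close>: such
    sequences vanish after index 0.\<close>
  have geometric: "x n = a ^ n * x 0" if "x \<in> power_space (Suc 0) a" for x n
  proof (induction n)
    case (Suc n)
    have "x (Suc n) = a * x n"
      using that act_linear[of a x n] by (simp add: root_space_def)
    then show ?case by (simp add: Suc)
  qed simp
  have "s 0 \<noteq> 0"
  proof
    assume "s 0 = 0"
    then have "s n = 0" for n using geometric[OF 0(1), of n] by simp
    then show False using 0(2) by (simp add: root_space_empty fun_eq_iff)
  qed
  then have "t n = t 0 / s 0 * s n" for n
    using geometric[OF 0(1), of n] geometric[OF 0(3), of n] by simp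
  then have "t - seq_scale (t 0 / s 0) s = 0"
    unfolding fun_eq_iff seq_scale_def minus_apply zero_fun_apply by (metis diff_self)
  then have "t - seq_scale (t 0 / s 0) s \<in> power_space 0 a"
    by (simp only: replicate_mset_0 root_space_empty singletonI)
  then show ?case ..
next
  case (Suc k)
  let ?D = "act [:- a, 1:]"
  have "?D s \<in> power_space (Suc k) a" "?D s \<notin> power_space k a" "?D t \<in> power_space (Suc k) a"
    using Suc.prems by (simp_all only: replicate_mset_Suc root_space_add_mset not_False_eq_True)
  from Suc.IH[OF this] obtain c where "?D t - seq_scale c (?D s) \<in> power_space k a" ..
  moreover have "?D (t - seq_scale c s) = ?D t - seq_scale c (?D s)"
    by (simp add: fun_eq_iff act_linear seq_scale_def algebra_simps)
  ultimately have "t - seq_scale c s \<in> power_space (Suc k) a"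
    by (simp only: replicate_mset_Suc root_space_add_mset)
  then show ?case ..
qed

text \<open>The iterates of \<open>s\<close> under E - a leave one witness in \<open>W\<close> at
  every level, and codimension at most 1 then fills the levels from the bottom up.\<close>

lemma power_space_le_invariant_subspace:
  assumes W: "seqs.subspace W" "\<And>x. x \<in> W \<Longrightarrow> act [:- a, 1:] x \<in> W"
    and "s \<in> W" "s \<in> power_space (Suc k) a" "s \<notin> power_space k a"
  shows "power_space (Suc k) a \<subseteq> W"
proof -
  have step: "power_space (Suc k) a \<subseteq> W"
    if s: "s \<in> W" "s \<in> power_space (Suc k) a" "s \<notin> power_space k a"
      and le: "power_space k a \<subseteq> W" for k s
  proof
    fix t assume "t \<in> power_space (Suc k) a"
    from power_space_codim_le_1[OF s(2,3) this] obtain c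
      where "t - seq_scale c s \<in> power_space k a" ..
    with le have "t - seq_scale c s \<in> W" by (rule subsetD)
    then have "(t - seq_scale c s) + seq_scale c s \<in> W"
      by (rule seqs.subspace_add[OF W(1) _ seqs.subspace_scale[OF W(1) s(1)]])
    then show "t \<in> W" by simp
  qed
  show ?thesis
    using assms(3-)
  proof (induction k arbitrary: s)
    case 0
    show ?case
      by (rule step[OF 0]) (simp add: root_space_empty seqs.subspace_0[OF W(1)])
  next
    case (Suc k)
    \<comment> \<open>\<open>x\<close> is a witness exactly one level lower, so the induction
      hypothesis puts that whole level into \<open>W\<close>.\<close>
    define x where "x = act [:- a, 1:] s"
    have "x \<in> W" unfolding x_def using Suc.prems(1) by (rule W(2))
    moreover have "x \<in> power_space (Suc k) a" "x \<notin> power_space k a"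
      using Suc.prems(2,3)
      by (simp_all only: x_def replicate_mset_Suc root_space_add_mset not_False_eq_True)
    ultimately have "power_space (Suc k) a \<subseteq> W" by (rule Suc.IH)
    then show ?case by (rule step[OF Suc.prems])
  qed
qed

text \<open>Take \<open>k\<close> least with \<open>W\<close> inside level \<open>k\<close>.
  Minimality gives an element of \<open>W\<close> outside the level below, and the previous lemma
  yields the other inclusion.\<close>

lemma invariant_subspace_is_power_space:
  assumes W: "seqs.subspace W" "\<And>x. x \<in> W \<Longrightarrow> act [:- a, 1:] x \<in> W"
    and "W \<subseteq> power_space N a"
  shows "\<exists>k. W = power_space k a"
proof -
  define k where "k = (LEAST k. W \<subseteq> power_space k a)"
  have le: "W \<subseteq> power_space k a" unfolding k_def by (rule LeastI[of _ N]) (rule assms)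
  have "power_space k a \<subseteq> W"
  proof (cases k)
    case 0
    then show ?thesis using seqs.subspace_0[OF W(1)] by (simp add: root_space_empty)
  next
    case (Suc j)
    then have "\<not> W \<subseteq> power_space j a" unfolding k_def by (metis lessI not_less_Least)
    then obtain s where "s \<in> W" "s \<notin> power_space j a" by blast
    then show ?thesis
      using power_space_le_invariant_subspace[OF W] le Suc by blast
  qed
  with le show ?thesis by blast
qed

text \<open>Each term of the twisted Leibniz rule lowers one exponent. The bound need not be sharp,
  since it serves only to confine the product to some level.\<close>

lemma mult_in_power_space:
  assumes "c \<in> power_space m a" "d \<in> power_space n b"
  shows "c * d \<in> power_space (m + n) (a * b)"
  using assms
proof (induction "m + n" arbitrary: m n c d)
  case 0
  then show ?case by (simp add: root_space_empty fun_eq_iff)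
next
  case (Suc N)
  show ?case
  proof (cases "m = 0 \<or> n = 0")
    case True
    with Suc.prems have "c = 0 \<or> d = 0" by (auto simp: root_space_empty)
    then show ?thesis by (auto simp: zero_in_root_space)
  next
    case False
    then obtain m' n' where mn: "m = Suc m'" "n = Suc n'" by (metis not0_implies_Suc)
    \<comment> \<open>The first term lowers \<open>m\<close>, while \<open>shift d\<close> remains
      at level \<open>n\<close>; the second lowers \<open>n\<close>. Both land in the same space
      because \<open>m' + n = m + n'\<close>.\<close>
    let ?x = "act [:- a, 1:] c * shift d" and ?y = "c * act [:- b, 1:] d"
    have "?x \<in> power_space (m' + n) (a * b)"
      using Suc.hyps(2) Suc.prems(1) mn
      by (intro Suc.hyps(1) shift_in_root_space Suc.prems(2)) (auto simp: root_space_add_mset)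
    moreover have "?y \<in> power_space (m + n') (a * b)"
      using Suc mn by (intro Suc.hyps(1)) (auto simp: root_space_add_mset)
    moreover have "act [:- (a * b), 1:] (c * d) = ?x + seq_scale a ?y"
      by (simp add: fun_eq_iff act_linear seq_scale_def shift_def algebra_simps)
    ultimately have "act [:- (a * b), 1:] (c * d) \<in> power_space (m' + n) (a * b)"
      using mn by (auto intro!: seqs.subspace_add seqs.subspace_scale subspace_root_space)
    then show ?thesis using mn by (simp add: root_space_add_mset)
  qed
qed

lemma subspace_prod_power_space: "\<exists>k. subspace_prod (power_space m a) (power_space n b) = power_space k (a * b)"
proof (rule invariant_subspace_is_power_space)
  let ?W = "subspace_prod (power_space m a) (power_space n b)"
  show sub: "seqs.subspace ?W" by (rule subspace_subspace_prod)
  show "?W \<subseteq> power_space (m + n) (a * b)"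
    by (intro subspace_prod_least subspace_root_space mult_in_power_space)
  fix x assume "x \<in> ?W"
  then show "act [:- (a * b), 1:] x \<in> ?W"
  proof (induction rule: subspace_prod_induct)
    case subspace
    show ?case
      using sub by (intro seqs.subspaceI)
        (auto simp: act_add_right act_scale_right intro: seqs.subspace_0 seqs.subspace_add seqs.subspace_scale)
  next
    case (mult c d)
    \<comment> \<open>Stability needs no Leibniz rule: E is multiplicative for the Hadamard product,
      and the rest is a scalar multiple.\<close>
    have "act [:- (a * b), 1:] (c * d) = shift c * shift d + seq_scale (- (a * b)) (c * d)"
      by (simp add: fun_eq_iff act_linear seq_scale_def shift_def)
    then show ?case
      using sub mult shift_in_root_space
      by (metis seqs.subspace_add seqs.subspace_scale subspace_prod_mem)
  qed
qed


section \<open>The semiring and its grading\<close>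

text \<open>Splits off the primary part at \<open>a\<close>; the two multisets have disjoint
  supports, so their union is \<open>A\<close>.\<close>

lemma root_space_decompose:
  "root_space A = subspace_sum (power_space (count A a) a) (root_space (filter_mset (\<lambda>x. x \<noteq> a) A))"
proof -
  have "A = replicate_mset (count A a) a \<union># filter_mset (\<lambda>x. x \<noteq> a) A"
    by (auto simp: multiset_eq_iff)
  then show ?thesis by (simp add: subspace_sum_root_space)
qed

text \<open>Every space is a finite sum of primary parts. The induction is on the number of distinct
  roots, removing one root with its full multiplicity.\<close>

lemma rec_spaces_over_induct [consumes 1, case_names zero power sum]:
  assumes "U \<in> rec_spaces_over M" "Q {0}"
    and power: "\<And>k a. a \<in> M \<Longrightarrow> Q (power_space k a)"
    and sum: "\<And>U V. U \<in> rec_spaces_over M \<Longrightarrow> V \<in> rec_spaces_over M \<Longrightarrow> Q U \<Longrightarrow> Q V \<Longrightarrow> Q (subspace_sum U V)"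
  shows "Q U"
proof -
  have "Q (root_space A)" if "set_mset A \<subseteq> M" for A
    using that
  proof (induction "card (set_mset A)" arbitrary: A rule: less_induct)
    case less
    show ?case
    proof (cases "A = {#}")
      case True
      then show ?thesis using assms(2) by (simp add: root_space_empty)
    next
      case False
      then obtain a where a: "a \<in># A" by blast
      let ?B = "filter_mset (\<lambda>x. x \<noteq> a) A"
      have "set_mset ?B \<subset> set_mset A" using a by auto
      then have "card (set_mset ?B) < card (set_mset A)" by (simp add: psubset_card_mono)
      then have "Q (root_space ?B)" using less by (intro less.hyps) auto
      moreover have "a \<in> M" using a less by auto
      then have "power_space (count A a) a \<in> rec_spaces_over M"
        unfolding rec_spaces_over_def
        by (intro CollectI exI[of _ "replicate_mset (count A a) a"]) auto
      moreover have "root_space ?B \<in> rec_spaces_over M"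
        unfolding rec_spaces_over_def using less by (intro CollectI exI[of _ ?B]) auto
      ultimately show ?thesis
        using power[OF \<open>a \<in> M\<close>] by (subst root_space_decompose[of _ a]) (intro sum)
    qed
  qed
  with assms(1) show ?thesis by (auto simp: rec_spaces_over_def)
qed

lemma subspace_rec_spaces_over: "U \<in> rec_spaces_over M \<Longrightarrow> seqs.subspace U"
  by (auto simp: rec_spaces_over_def subspace_root_space)

lemma zero_in_rec_spaces_over: "{0} \<in> rec_spaces_over M"
  unfolding rec_spaces_over_def by (intro CollectI exI[of _ "{#}"]) (simp add: root_space_empty)

lemma power_space_in_rec_spaces_over: "a \<in> M \<Longrightarrow> power_space k a \<in> rec_spaces_over M"
  unfolding rec_spaces_over_def by (intro CollectI exI[of _ "replicate_mset k a"]) auto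

lemma subspace_sum_in_rec_spaces_over:
  assumes "U \<in> rec_spaces_over M" "V \<in> rec_spaces_over M"
  shows "subspace_sum U V \<in> rec_spaces_over M"
proof -
  obtain A B where "U = root_space A" "V = root_space B" "set_mset A \<subseteq> M" "set_mset B \<subseteq> M"
    using assms by (auto simp: rec_spaces_over_def)
  then show ?thesis
    unfolding rec_spaces_over_def
    by (intro CollectI exI[of _ "A \<union># B"]) (auto simp: subspace_sum_root_space)
qed

text \<open>Distributivity, used in each factor in turn, reduces the claim to two primary parts,
  whose product has the single root \<open>a * b\<close>.\<close>

lemma subspace_prod_in_rec_spaces_over:
  assumes M: "\<And>a b. a \<in> M \<Longrightarrow> b \<in> M \<Longrightarrow> a * b \<in> M"
    and U: "U \<in> rec_spaces_over M" and V: "V \<in> rec_spaces_over M"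
  shows "subspace_prod U V \<in> rec_spaces_over M"
  using U
proof (induction rule: rec_spaces_over_induct)
  case zero
  show ?case by (simp add: subspace_prod_zero zero_in_rec_spaces_over)
next
  case (sum U U')
  then show ?case
    by (simp add: subspace_prod_sum_distrib subspace_rec_spaces_over subspace_sum_in_rec_spaces_over)
next
  case (power m a)
  show ?case
    using V
  proof (induction rule: rec_spaces_over_induct)
    case zero
    show ?case by (simp add: subspace_prod_commute[of _ "{0}"] subspace_prod_zero zero_in_rec_spaces_over)
  next
    case (sum V V')
    then show ?case
      by (simp add: subspace_prod_commute[of "power_space m a"] subspace_prod_sum_distrib
          subspace_rec_spaces_over subspace_sum_in_rec_spaces_over)
  next
    case (power n b)
    then show ?case
      using subspace_prod_power_space[of m a n b] M \<open>a \<in> M\<close>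
      by (metis power_space_in_rec_spaces_over)
  qed
qed

section \<open>Semiring laws and grading over a multiplicative submonoid\<close>

lemma zero_subspace_semiring: "\<zero>\<^bsub>subspace_semiring S\<^esub> = {0}"
  using root_space_eq[of "{#}", symmetric] by (simp add: subspace_semiring_def root_space_empty)

lemma one_subspace_semiring: "\<one>\<^bsub>subspace_semiring S\<^esub> = root_space {#1#}"
  using root_space_eq[of "{#1#}", symmetric] by (simp add: subspace_semiring_def)

lemma subspace_semiring_simps:
  "carrier (subspace_semiring S) = S"
  "U \<oplus>\<^bsub>subspace_semiring S\<^esub> V = subspace_sum U V"
  "U \<otimes>\<^bsub>subspace_semiring S\<^esub> V = subspace_prod U V"
  by (simp_all add: subspace_semiring_def)

lemma commutative_semiring_rec_spaces_over:
  assumes one: "1 \<in> M" and M: "\<And>a b. a \<in> M \<Longrightarrow> b \<in> M \<Longrightarrow> a * b \<in> M"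
  shows "commutative_semiring (subspace_semiring (rec_spaces_over M))"
proof -
  let ?R = "subspace_semiring (rec_spaces_over M)"
  note simps = subspace_semiring_simps zero_subspace_semiring one_subspace_semiring
  have one_in: "root_space {#1#} \<in> rec_spaces_over M"
    using power_space_in_rec_spaces_over[OF one, of 1] by simp
  have add: "abelian_monoid ?R"
  proof (rule abelian_monoidI, unfold simps)
    fix U V W
    show "subspace_sum U V = subspace_sum V U" by (rule subspace_sum_commute)
    show "subspace_sum (subspace_sum U V) W = subspace_sum U (subspace_sum V W)"
      by (rule subspace_sum_assoc)
  qed (simp_all add: subspace_sum_in_rec_spaces_over zero_in_rec_spaces_over subspace_sum_zero)
  have mult: "comm_monoid ?R"
  proof (rule comm_monoidI, unfold simps)
    fix U V W
    show "subspace_prod U V = subspace_prod V U" by (rule subspace_prod_commute)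
    show "subspace_prod (subspace_prod U V) W = subspace_prod U (subspace_prod V W)"
      by (rule subspace_prod_assoc)
  qed (simp_all add: M one_in subspace_prod_in_rec_spaces_over subspace_prod_one subspace_rec_spaces_over)
  interpret abelian_monoid ?R by (rule add)
  interpret comm_monoid ?R by (rule mult)
  show ?thesis
  proof (unfold_locales, unfold simps)
    fix U V W
    assume UVW: "U \<in> rec_spaces_over M" "V \<in> rec_spaces_over M" "W \<in> rec_spaces_over M"
    show distr: "subspace_prod (subspace_sum U V) W = subspace_sum (subspace_prod U W) (subspace_prod V W)"
      using UVW by (simp add: subspace_prod_sum_distrib subspace_rec_spaces_over)
    then show "subspace_prod W (subspace_sum U V) = subspace_sum (subspace_prod W U) (subspace_prod W V)"
      by (simp add: subspace_prod_commute)
  next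
    fix U
    show "subspace_prod {0} U = {0}" by (rule subspace_prod_zero)
    then show "subspace_prod U {0} = {0}" by (simp add: subspace_prod_commute)
  next
    have "(\<lambda>n. 1 :: 'a) \<in> root_space {#1#}" by (auto simp: root_space_one)
    moreover have "(\<lambda>n. 1) \<notin> {0 :: nat \<Rightarrow> 'a}" by (simp add: fun_eq_iff)
    ultimately show "root_space {#1#} \<noteq> {0 :: nat \<Rightarrow> 'a}" by blast
  qed
qed

lemma graded_rec_spaces_over:
  assumes one: "1 \<in> M" and M: "\<And>a b. a \<in> M \<Longrightarrow> b \<in> M \<Longrightarrow> a * b \<in> M"
  shows "graded_by (subspace_semiring (rec_spaces_over M)) (mult_monoid M)"
proof -
  let ?R = "subspace_semiring (rec_spaces_over M)"
  \<comment> \<open>The piece of degree \<open>a\<close> is the chain of all L((X - a)^k), including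
    {0} for \<open>k = 0\<close>.\<close>
  define C where "C a = range (\<lambda>k. power_space k a)" for a :: 'a
  note simps = subspace_semiring_simps zero_subspace_semiring one_subspace_semiring
  interpret commutative_semiring ?R
    by (rule commutative_semiring_rec_spaces_over[OF assms])
  have C: "C a \<subseteq> rec_spaces_over M" if "a \<in> M" for a
    using that by (auto simp: C_def power_space_in_rec_spaces_over)
  have "monoid (mult_monoid M)"
    by (rule monoidI) (use assms in \<open>auto simp: mult_monoid_def mult.assoc\<close>)
  moreover have "additive_subsemigroup (C a) ?R" if "a \<in> M" for a
  proof -
    \<comment> \<open>In a chain the sum of two members is the larger one, hence the exponent
      \<open>max m n\<close>.\<close>
    have "replicate_mset m a \<union># replicate_mset n a = replicate_mset (max m n) a" for m n
      by (auto simp: multiset_eq_iff)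
    then have "subspace_sum x y \<in> C a" if "x \<in> C a" "y \<in> C a" for x y
      using that by (auto simp: C_def subspace_sum_root_space)
    then show ?thesis
      using C[OF that] by (auto simp: additive_subsemigroup_def simps C_def)
  qed
  moreover have "rec_spaces_over M =
      {(\<Oplus>\<^bsub>?R\<^esub>\<alpha>\<in>A. a \<alpha>) | a A. finite A \<and> A \<subseteq> M \<and> (\<forall>\<alpha>\<in>A. a \<alpha> \<in> C \<alpha>)}" (is "_ = ?S")
  proof
    show "?S \<subseteq> rec_spaces_over M"
    proof clarify
      fix a A assume "A \<subseteq> M" "\<forall>\<alpha>\<in>A. a \<alpha> \<in> C \<alpha>"
      then have "a \<in> A \<rightarrow> carrier ?R" using C by (auto simp: simps)
      then show "finsum ?R a A \<in> rec_spaces_over M"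
        using finsum_closed by (simp add: simps)
    qed
  next
    have sum: "finsum ?R (\<lambda>\<alpha>. power_space (f \<alpha>) \<alpha>) A = root_space (\<Sum>\<alpha>\<in>A. replicate_mset (f \<alpha>) \<alpha>)"
      if "finite A" "A \<subseteq> M" for A f
      using that
    proof (induction A)
      case empty
      show ?case by (simp add: simps root_space_empty)
    next
      case (insert \<beta> A)
      let ?T = "\<Sum>\<alpha>\<in>A. replicate_mset (f \<alpha>) \<alpha>"
      \<comment> \<open>Since \<beta> is a new root, the sum of multisets agrees with the union,
        which is what subspace sums produce.\<close>
      have "count ?T \<beta> = 0" using insert by (auto simp: count_sum)
      then have "replicate_mset (f \<beta>) \<beta> + ?T = replicate_mset (f \<beta>) \<beta> \<union># ?T"
        by (auto simp: multiset_eq_iff)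
      moreover have "finsum ?R (\<lambda>\<alpha>. power_space (f \<alpha>) \<alpha>) (insert \<beta> A) =
          subspace_sum (power_space (f \<beta>) \<beta>) (finsum ?R (\<lambda>\<alpha>. power_space (f \<alpha>) \<alpha>) A)"
        using insert
        by (subst finsum_insert) (auto simp: simps power_space_in_rec_spaces_over)
      ultimately show ?case
        using insert by (simp add: subspace_sum_root_space)
    qed
    show "rec_spaces_over M \<subseteq> ?S"
    proof
      fix U assume "U \<in> rec_spaces_over M"
      then obtain A where A: "U = root_space A" "set_mset A \<subseteq> M" by (auto simp: rec_spaces_over_def)
      have "(\<Sum>\<alpha>\<in>set_mset A. replicate_mset (count A \<alpha>) \<alpha>) = A"
        by (auto simp: multiset_eq_iff count_sum not_in_iff)
      then have "U = finsum ?R (\<lambda>\<alpha>. power_space (count A \<alpha>) \<alpha>) (set_mset A)"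
        using A by (simp add: sum)
      then show "U \<in> ?S" using A(2) by (auto simp: C_def)
    qed
  qed
  moreover have "subspace_prod x y \<in> C (a * b)" if "x \<in> C a" "y \<in> C b" for a b x y
    using that subspace_prod_power_space by (fastforce simp: C_def)
  moreover have "finsum ?R a A \<noteq> {0}"
    if "finite A" "A \<noteq> {}" "A \<subseteq> M" and a: "\<forall>\<alpha>\<in>A. a \<alpha> \<in> C \<alpha> \<and> a \<alpha> \<noteq> {0}" for A a
  proof
    assume eq: "finsum ?R a A = {0}"
    \<comment> \<open>Subspaces cannot cancel: the sum contains the summand at \<alpha>, so a zero
      sum would force \<open>a \<alpha> = {0}\<close>.\<close>
    obtain \<alpha> B where B: "A = insert \<alpha> B" "\<alpha> \<notin> B" using \<open>A \<noteq> {}\<close> by (meson ex_in_conv mk_disjoint_insert)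
    have mem: "a \<in> B \<rightarrow> carrier ?R" "a \<alpha> \<in> carrier ?R"
      using that C B by (auto simp: simps)
    then have "finsum ?R a A = subspace_sum (a \<alpha>) (finsum ?R a B)"
      using that B by (simp add: finsum_insert) (simp add: simps)
    moreover have "finsum ?R a B \<in> rec_spaces_over M" using finsum_closed[OF mem(1)] by (simp add: simps)
    ultimately have "a \<alpha> \<subseteq> {0}"
      using eq subspace_sum_superset seqs.subspace_0[OF subspace_rec_spaces_over] by metis
    moreover have "0 \<in> a \<alpha>"
      using mem(2) seqs.subspace_0[OF subspace_rec_spaces_over] by (simp add: simps)
    ultimately show False using a B by auto
  qed
  ultimately show ?thesis
    unfolding graded_by_def is_grading_def
    using semiring_axioms
    by (intro conjI exI[of _ C]) (simp_all add: simps mult_monoid_def)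
qed

theorem theorem4p4:
  shows "(commutative_semiring (subspace_semiring (rec_spaces_star :: (nat \<Rightarrow> 'a::field) set set)) \<and>
          graded_by (subspace_semiring (rec_spaces_star :: (nat \<Rightarrow> 'a) set set))
            (mult_monoid (UNIV - {0 :: 'a}))) \<and>
         (commutative_semiring (subspace_semiring (rec_spaces :: (nat \<Rightarrow> 'a) set set)) \<and>
          graded_by (subspace_semiring (rec_spaces :: (nat \<Rightarrow> 'a) set set))
            (mult_monoid (UNIV :: 'a set)))"
  unfolding rec_spaces_eq rec_spaces_star_eq
  by (intro conjI commutative_semiring_rec_spaces_over graded_rec_spaces_over) auto

end
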